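(* Let $M=[0,1]\cup\{p\}$, where $p\notin[0,1]$, be the metric space with distinguished point $0\in[0,1]$ and metric $d(x,y)=|x-y|$ if $x,y\in[0,1]$, and $d(x,y)=1/2$ if $x\ne y$ and ($x=p$ or $y=p$). Then $\mathrm{lip}_0^u(M)$ is not an $M$-ideal in $\mathrm{Lip}_0(M)$.
   Context: All Banach spaces are real. For a metric space $(M,d)$ with distinguished point $0$, $\mathrm{Lip}_0(M)$ is the Banach space of all Lipschitz functions $f\colon M\to\mathbb{R}$ with $f(0)=0$, with norm $\|f\|=\sup\{|f(x)-f(y)|/d(x,y): x\ne y\}$. Write $B[0,r]=\{y\in M:d(0,y)\le r\}$. A function $f\in\mathrm{Lip}_0(M)$ is uniformly locally flat if for every $\varepsilon>0$ there is $\delta>0$ such that $d(x,y)<\delta$ (with $x\neq y$) implies $|f(x)-f(y)|<\varepsilon d(x,y)$. It is flat at infinity if $$\lim_{r\to\infty}\ \sup_{x\ne y,\ x\notin B[0,r]\text{ or }y\notin B[0,r]}\frac{f(x)-f(y)}{d(x,y)}=0$$ (a supremum over the empty set being $0$, so the condition is vacuous when $M$ is bounded). $\mathrm{lip}_0^u(M)$ is the set of all $f\in\mathrm{Lip}_0(M)$ that are uniformly locally flat and flat at infinity, with the norm of $\mathrm{Lip}_0(M)$. A subspace $Y$ of a Banach space $X$, with annihilator $Y^\perp\subset X^*$, is an $M$-ideal in $X$ if there is a linear projection $P$ on $X^*$ with $\ker P=Y^\perp$ and $\|x^*\|=\|Px^*\|+\|x^*-Px^*\|$ for all $x^*\in X^*$.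 *)

theory Defs
  imports "HOL-Analysis.Analysis"
begin

text \<open>Supremum of a set of reals, with the convention that the supremum of the empty set is 0
  (the library leaves \<^term>\<open>Sup {} :: real\<close> unspecified).\<close>

definition sup0 :: "real set \<Rightarrow> real" where
  "sup0 A = (if A = {} then 0 else Sup A)"

lemma sup0_upper: "bdd_above A \<Longrightarrow> a \<in> A \<Longrightarrow> a \<le> sup0 A"
  unfolding sup0_def by (auto intro: cSup_upper)

lemma sup0_least: "0 \<le> c \<Longrightarrow> (\<And>a. a \<in> A \<Longrightarrow> a \<le> c) \<Longrightarrow> sup0 A \<le> c"
  unfolding sup0_def by (auto intro: cSup_least)

section \<open>The Banach space of Lipschitz functions vanishing at the distinguished point\<close>

text \<open>A metric space with distinguished point is a type of sort \<open>{metric_space, zero}\<close>;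
  the distinguished point is \<^term>\<open>0\<close>, and no algebraic structure is attached to it.\<close>

typedef (overloaded) 'a lip0 =
  "{f :: 'a::{metric_space, zero} \<Rightarrow> real. (\<exists>C. C-lipschitz_on UNIV f) \<and> f 0 = 0}"
  morphisms lip0_apply Lip0
  by (rule exI[of _ "\<lambda>_. 0"]) (auto intro!: exI[of _ 0] lipschitz_onI)

lemma lip0_apply_zero [simp]: "lip0_apply f 0 = 0"
  using lip0_apply[of f] by simp

lemma lip0_lipschitz:
  obtains C where "0 \<le> C" "\<And>x y. \<bar>lip0_apply f x - lip0_apply f y\<bar> \<le> C * dist x y"
proof -
  obtain C where "C-lipschitz_on UNIV (lip0_apply f)"
    using lip0_apply[of f] by auto
  then show thesis
    using that[of C] by (auto simp: lipschitz_on_def dist_real_def)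
qed

lemma lip0_memI:
  assumes "\<And>x y. \<bar>f x - f y\<bar> \<le> C * dist x y" and "f 0 = 0"
  shows "f \<in> {f. (\<exists>C. C-lipschitz_on UNIV f) \<and> f 0 = (0::real)}"
proof -
  have "\<bar>f x - f y\<bar> \<le> max 0 C * dist x y" for x y
    using assms(1)[of x y] mult_right_mono[of C "max 0 C" "dist x y"] by auto
  then have "(max 0 C)-lipschitz_on UNIV f"
    by (auto simp: lipschitz_on_def dist_real_def)
  then show ?thesis using assms(2) by blast
qed

lemma lip0_eqI: "(\<And>x. lip0_apply f x = lip0_apply g x) \<Longrightarrow> f = g"
  by (simp add: lip0_apply_inject[symmetric] ext)

instantiation lip0 :: ("{metric_space, zero}") real_normed_vector
begin

definition zero_lip0 :: "'a lip0" where
  "0 = Lip0 (\<lambda>_. 0)"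

definition plus_lip0 :: "'a lip0 \<Rightarrow> 'a lip0 \<Rightarrow> 'a lip0" where
  "f + g = Lip0 (\<lambda>x. lip0_apply f x + lip0_apply g x)"

definition minus_lip0 :: "'a lip0 \<Rightarrow> 'a lip0 \<Rightarrow> 'a lip0" where
  "f - g = Lip0 (\<lambda>x. lip0_apply f x - lip0_apply g x)"

definition uminus_lip0 :: "'a lip0 \<Rightarrow> 'a lip0" where
  "- f = Lip0 (\<lambda>x. - lip0_apply f x)"

definition scaleR_lip0 :: "real \<Rightarrow> 'a lip0 \<Rightarrow> 'a lip0" where
  "c *\<^sub>R f = Lip0 (\<lambda>x. c * lip0_apply f x)"

definition norm_lip0 :: "'a lip0 \<Rightarrow> real" where
  "norm f = sup0 {\<bar>lip0_apply f x - lip0_apply f y\<bar> / dist x y | x y. x \<noteq> y}"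

definition dist_lip0 :: "'a lip0 \<Rightarrow> 'a lip0 \<Rightarrow> real" where
  "dist (f :: 'a lip0) g = norm (f - g)"

definition sgn_lip0 :: "'a lip0 \<Rightarrow> 'a lip0" where
  "sgn (f :: 'a lip0) = inverse (norm f) *\<^sub>R f"

definition uniformity_lip0 :: "('a lip0 \<times> 'a lip0) filter" where
  "uniformity = (INF e\<in>{0<..}. principal {(f, g :: 'a lip0). dist f g < e})"

definition open_lip0 :: "'a lip0 set \<Rightarrow> bool" where
  "open (U :: 'a lip0 set) \<longleftrightarrow> (\<forall>f\<in>U. \<forall>\<^sub>F (f', g) in uniformity. f' = f \<longrightarrow> g \<in> U)"

lemma lip0_apply_0: "lip0_apply (0 :: 'a lip0) x = 0"
  unfolding zero_lip0_def
  by (subst Lip0_inverse) (rule lip0_memI[where C = 0], auto)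

lemma lip0_apply_add:
  "lip0_apply (f + g :: 'a lip0) x = lip0_apply f x + lip0_apply g x"
proof -
  obtain C where C: "\<And>x y. \<bar>lip0_apply f x - lip0_apply f y\<bar> \<le> C * dist x y"
    using lip0_lipschitz by blast
  obtain D where D: "\<And>x y. \<bar>lip0_apply g x - lip0_apply g y\<bar> \<le> D * dist x y"
    using lip0_lipschitz by blast
  have "\<bar>lip0_apply f x + lip0_apply g x - (lip0_apply f y + lip0_apply g y)\<bar>
      \<le> (C + D) * dist x y" for x y
    using C[of x y] D[of x y] by (simp add: algebra_simps)
  then show ?thesis
    unfolding plus_lip0_def by (subst Lip0_inverse) (rule lip0_memI, auto)
qed

lemma lip0_apply_scaleR: "lip0_apply (c *\<^sub>R f :: 'a lip0) x = c * lip0_apply f x"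
proof -
  obtain C where C: "\<And>x y. \<bar>lip0_apply f x - lip0_apply f y\<bar> \<le> C * dist x y"
    using lip0_lipschitz by blast
  have "\<bar>c * lip0_apply f x - c * lip0_apply f y\<bar> \<le> (\<bar>c\<bar> * C) * dist x y" for x y
    using mult_left_mono[OF C[of x y], of "\<bar>c\<bar>"]
    by (simp add: abs_mult[symmetric] right_diff_distrib mult.assoc)
  then show ?thesis
    unfolding scaleR_lip0_def by (subst Lip0_inverse) (rule lip0_memI, auto)
qed

lemma lip0_apply_uminus: "lip0_apply (- f :: 'a lip0) x = - lip0_apply f x"
  using lip0_apply_scaleR[of "-1" f x] unfolding uminus_lip0_def scaleR_lip0_def by simp

lemma lip0_apply_diff:
  "lip0_apply (f - g :: 'a lip0) x = lip0_apply f x - lip0_apply g x"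
proof -
  have "f - g = f + - g"
    unfolding minus_lip0_def plus_lip0_def by (simp add: lip0_apply_uminus)
  then show ?thesis by (simp add: lip0_apply_add lip0_apply_uminus)
qed

lemmas lip0_apply_simps =
  lip0_apply_0 lip0_apply_add lip0_apply_diff lip0_apply_uminus lip0_apply_scaleR

lemma lip0_norm_bound:
  "\<bar>lip0_apply f x - lip0_apply f y\<bar> \<le> norm (f :: 'a lip0) * dist x y"
proof (cases "x = y")
  case False
  obtain C where C: "\<And>x y. \<bar>lip0_apply f x - lip0_apply f y\<bar> \<le> C * dist x y"
    using lip0_lipschitz by blast
  have "bdd_above {\<bar>lip0_apply f x - lip0_apply f y\<bar> / dist x y | x y. x \<noteq> y}"
    using C by (auto intro!: bdd_aboveI[of _ C] simp: divide_le_eq)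
  then have "\<bar>lip0_apply f x - lip0_apply f y\<bar> / dist x y \<le> norm f"
    unfolding norm_lip0_def using False by (intro sup0_upper) auto
  then show ?thesis using False by (simp add: divide_le_eq)
qed simp

lemma lip0_norm_le:
  assumes "0 \<le> C" "\<And>x y. \<bar>lip0_apply f x - lip0_apply f y\<bar> \<le> C * dist x y"
  shows "norm (f :: 'a lip0) \<le> C"
  unfolding norm_lip0_def using assms by (intro sup0_least) (auto simp: divide_le_eq)

lemma lip0_norm_nonneg: "0 \<le> norm (f :: 'a lip0)"
proof (cases "\<exists>x y :: 'a. x \<noteq> y")
  case True
  then obtain x y :: 'a where "x \<noteq> y" by blast
  have "0 \<le> norm f * dist x y"
    using lip0_norm_bound[of f x y] abs_ge_zero order_trans by blast
  then show ?thesis using \<open>x \<noteq> y\<close> by (simp add: zero_le_mult_iff)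
next
  case False
  then show ?thesis by (simp add: norm_lip0_def sup0_def)
qed

lemma lip0_norm_scaleR_le: "norm (c *\<^sub>R f :: 'a lip0) \<le> \<bar>c\<bar> * norm f"
proof (rule lip0_norm_le)
  fix x y :: 'a
  show "\<bar>lip0_apply (c *\<^sub>R f) x - lip0_apply (c *\<^sub>R f) y\<bar> \<le> \<bar>c\<bar> * norm f * dist x y"
    using mult_left_mono[OF lip0_norm_bound[of f x y], of "\<bar>c\<bar>"]
    by (simp add: lip0_apply_simps abs_mult[symmetric] right_diff_distrib mult.assoc)
qed (simp add: lip0_norm_nonneg)

instance
proof
  fix f g h :: "'a lip0" and a b :: real
  show "f + g + h = f + (g + h)" "f + g = g + f" "0 + f = f" "- f + f = 0" "f - g = f + - g"
    "a *\<^sub>R (f + g) = a *\<^sub>R f + a *\<^sub>R g" "(a + b) *\<^sub>R f = a *\<^sub>R f + b *\<^sub>R f"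
    "a *\<^sub>R b *\<^sub>R f = (a * b) *\<^sub>R f" "1 *\<^sub>R f = f"
    by (rule lip0_eqI; simp add: lip0_apply_simps algebra_simps)+
  show "dist f g = norm (f - g)" by (rule dist_lip0_def)
  show "sgn f = inverse (norm f) *\<^sub>R f" by (rule sgn_lip0_def)
  show "uniformity = (INF e\<in>{0<..}. principal {(f, g :: 'a lip0). dist f g < e})"
    by (rule uniformity_lip0_def)
  show "open U \<longleftrightarrow> (\<forall>f\<in>U. \<forall>\<^sub>F (f', g) in uniformity. f' = f \<longrightarrow> g \<in> U)" for U :: "'a lip0 set"
    by (rule open_lip0_def)
  show "norm f = 0 \<longleftrightarrow> f = 0"
  proof
    assume "norm f = 0"
    then have "lip0_apply f x = 0" for x
      using lip0_norm_bound[of f x 0] by simp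
    then show "f = 0" by (intro lip0_eqI) (simp add: lip0_apply_simps)
  next
    assume "f = 0"
    then have "norm f \<le> 0" by (intro lip0_norm_le) (auto simp: lip0_apply_simps)
    then show "norm f = 0" using lip0_norm_nonneg[of f] by simp
  qed
  show "norm (f + g) \<le> norm f + norm g"
  proof (rule lip0_norm_le)
    fix x y :: 'a
    show "\<bar>lip0_apply (f + g) x - lip0_apply (f + g) y\<bar> \<le> (norm f + norm g) * dist x y"
      using lip0_norm_bound[of f x y] lip0_norm_bound[of g x y]
      by (simp add: lip0_apply_simps algebra_simps)
  qed (simp add: lip0_norm_nonneg)
  show "norm (a *\<^sub>R f) = \<bar>a\<bar> * norm f"
  proof (rule antisym[OF lip0_norm_scaleR_le])
    show "\<bar>a\<bar> * norm f \<le> norm (a *\<^sub>R f)"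
    proof (cases "a = 0")
      case False
      have "inverse a *\<^sub>R a *\<^sub>R f = f"
        using False by (intro lip0_eqI) (simp add: lip0_apply_simps)
      then have "norm f \<le> \<bar>inverse a\<bar> * norm (a *\<^sub>R f)"
        using lip0_norm_scaleR_le[of "inverse a" "a *\<^sub>R f"] by simp
      then show ?thesis using False by (simp add: field_simps)
    qed (simp add: lip0_norm_nonneg)
  qed
qed

end

instance lip0 :: ("{metric_space, zero}") banach
proof
  fix F :: "nat \<Rightarrow> 'a lip0"
  assume F: "Cauchy F"
  have pt: "\<bar>lip0_apply f x\<bar> \<le> norm f * dist x 0" for f :: "'a lip0" and x
    using lip0_norm_bound[of f x 0] by simp
  have "Cauchy (\<lambda>n. lip0_apply (F n) x)" for x
  proof (rule metric_CauchyI)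
    fix e :: real assume "0 < e"
    then have "0 < e / (dist x 0 + 1)" by (simp add: add_nonneg_pos)
    then obtain N where N: "\<And>m n. N \<le> m \<Longrightarrow> N \<le> n \<Longrightarrow> norm (F m - F n) < e / (dist x 0 + 1)"
      using CauchyD[OF F] by blast
    have "dist (lip0_apply (F m) x) (lip0_apply (F n) x) < e" if "N \<le> m" "N \<le> n" for m n
    proof -
      have "dist (lip0_apply (F m) x) (lip0_apply (F n) x) \<le> norm (F m - F n) * dist x 0"
        using pt[of "F m - F n" x] by (simp add: lip0_apply_simps dist_real_def)
      also have "\<dots> \<le> norm (F m - F n) * (dist x 0 + 1)"
        by (intro mult_left_mono) auto
      also have "\<dots> < e"
        using N[OF that] by (simp add: less_divide_eq add_nonneg_pos)
      finally show ?thesis .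
    qed
    then show "\<exists>N. \<forall>m\<ge>N. \<forall>n\<ge>N. dist (lip0_apply (F m) x) (lip0_apply (F n) x) < e"
      by blast
  qed
  then have "\<exists>l. (\<lambda>n. lip0_apply (F n) x) \<longlonglongrightarrow> l" for x
    by (simp add: Cauchy_convergent_iff convergent_def)
  then obtain g where g: "\<And>x. (\<lambda>n. lip0_apply (F n) x) \<longlonglongrightarrow> g x"
    by metis
  have close: "\<exists>N. \<forall>n\<ge>N. \<forall>x y.
      \<bar>(lip0_apply (F n) x - g x) - (lip0_apply (F n) y - g y)\<bar> \<le> e * dist x y" if e: "0 < e" for e
  proof -
    obtain N where N: "\<And>m n. N \<le> m \<Longrightarrow> N \<le> n \<Longrightarrow> norm (F m - F n) < e"
      using CauchyD[OF F e] by blast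
    have "\<bar>(lip0_apply (F n) x - g x) - (lip0_apply (F n) y - g y)\<bar> \<le> e * dist x y"
      if "N \<le> n" for n x y
    proof (rule tendsto_upperbound)
      show "(\<lambda>m. \<bar>(lip0_apply (F n) x - lip0_apply (F m) x) -
          (lip0_apply (F n) y - lip0_apply (F m) y)\<bar>)
        \<longlonglongrightarrow> \<bar>(lip0_apply (F n) x - g x) - (lip0_apply (F n) y - g y)\<bar>"
        by (intro tendsto_intros g)
      show "\<forall>\<^sub>F m in sequentially. \<bar>(lip0_apply (F n) x - lip0_apply (F m) x) -
          (lip0_apply (F n) y - lip0_apply (F m) y)\<bar> \<le> e * dist x y"
      proof (rule eventually_sequentiallyI)
        fix m assume "N \<le> m"
        have "\<bar>lip0_apply (F n - F m) x - lip0_apply (F n - F m) y\<bar>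
            \<le> norm (F n - F m) * dist x y"
          by (rule lip0_norm_bound)
        also have "\<dots> \<le> e * dist x y"
          using N[OF \<open>N \<le> n\<close> \<open>N \<le> m\<close>] by (intro mult_right_mono) auto
        finally show "\<bar>(lip0_apply (F n) x - lip0_apply (F m) x) -
          (lip0_apply (F n) y - lip0_apply (F m) y)\<bar> \<le> e * dist x y"
          by (simp add: lip0_apply_simps)
      qed
    qed simp
    then show ?thesis by blast
  qed
  obtain N where N: "\<And>x y.
      \<bar>(lip0_apply (F N) x - g x) - (lip0_apply (F N) y - g y)\<bar> \<le> 1 * dist x y"
    using close[of 1] by auto
  have "\<bar>g x - g y\<bar> \<le> (norm (F N) + 1) * dist x y" for x y
    using N[of x y] lip0_norm_bound[of "F N" x y] by (simp add: algebra_simps)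
  moreover have "g 0 = 0"
    using LIMSEQ_unique[OF g[of 0]] by simp
  ultimately have G: "lip0_apply (Lip0 g) = g"
    by (intro Lip0_inverse lip0_memI)
  have "F \<longlonglongrightarrow> Lip0 g"
  proof (rule LIMSEQ_I)
    fix e :: real assume "0 < e"
    then obtain N where N: "\<And>n x y. N \<le> n \<Longrightarrow>
        \<bar>(lip0_apply (F n) x - g x) - (lip0_apply (F n) y - g y)\<bar> \<le> (e / 2) * dist x y"
      using close[of "e / 2"] by auto
    have "norm (F n - Lip0 g) < e" if "N \<le> n" for n
    proof -
      have "norm (F n - Lip0 g) \<le> e / 2"
        using N[OF that] \<open>0 < e\<close> by (intro lip0_norm_le) (auto simp: lip0_apply_simps G)
      then show ?thesis using \<open>0 < e\<close> by simp
    qed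
    then show "\<exists>no. \<forall>n\<ge>no. norm (F n - Lip0 g) < e" by blast
  qed
  then show "convergent F" by (auto simp: convergent_def)
qed

section \<open>Uniformly locally flat functions that are flat at infinity\<close>

definition uniformly_locally_flat :: "('a::metric_space \<Rightarrow> real) \<Rightarrow> bool" where
  "uniformly_locally_flat f \<longleftrightarrow>
    (\<forall>\<epsilon>>0. \<exists>\<delta>>0. \<forall>x y. x \<noteq> y \<and> dist x y < \<delta> \<longrightarrow> \<bar>f x - f y\<bar> < \<epsilon> * dist x y)"

definition flat_at_infinity :: "('a::{metric_space, zero} \<Rightarrow> real) \<Rightarrow> bool" where
  "flat_at_infinity f \<longleftrightarrow>
    ((\<lambda>r. sup0 {(f x - f y) / dist x y | x y.
              x \<noteq> y \<and> (x \<notin> cball 0 r \<or> y \<notin> cball 0 r)}) \<longlongrightarrow> 0) at_top"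

definition lip0_u :: "'a::{metric_space, zero} lip0 set" where
  "lip0_u = {f. uniformly_locally_flat (lip0_apply f) \<and> flat_at_infinity (lip0_apply f)}"

lemma flat_at_infinity_iff:
  fixes f :: "'a::{metric_space, zero} lip0"
  shows "flat_at_infinity (lip0_apply f) \<longleftrightarrow>
    (\<forall>\<epsilon>>0. \<exists>R. \<forall>x y. x \<noteq> y \<and> (x \<notin> cball 0 R \<or> y \<notin> cball 0 R) \<longrightarrow>
      \<bar>lip0_apply f x - lip0_apply f y\<bar> \<le> \<epsilon> * dist x y)"
    (is "_ \<longleftrightarrow> ?R")
proof -
  define A where "A r = {(lip0_apply f x - lip0_apply f y) / dist x y | x y.
      x \<noteq> y \<and> (x \<notin> cball 0 r \<or> y \<notin> cball 0 r)}" for r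
  have A_E: "\<exists>x y. a = (lip0_apply f x - lip0_apply f y) / dist x y \<and>
      x \<noteq> y \<and> (x \<notin> cball 0 r \<or> y \<notin> cball 0 r)" if "a \<in> A r" for a r
    using that unfolding A_def mem_Collect_eq .
  have A_I: "(lip0_apply f x - lip0_apply f y) / dist x y \<in> A r"
    if "x \<noteq> y" "x \<notin> cball 0 r \<or> y \<notin> cball 0 r" for x y r
    unfolding A_def mem_Collect_eq
    by (rule exI[of _ x], rule exI[of _ y], intro conjI refl that)
  have bdd: "bdd_above (A r)" for r
  proof (rule bdd_aboveI[of _ "norm f"])
    fix a assume "a \<in> A r"
    then obtain x y where "x \<noteq> y" "a = (lip0_apply f x - lip0_apply f y) / dist x y"
      using A_E by metis
    then show "a \<le> norm f"
      using lip0_norm_bound[of f x y] by (simp add: divide_le_eq)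
  qed
  have up: "\<bar>lip0_apply f x - lip0_apply f y\<bar> \<le> sup0 (A r) * dist x y"
    if "x \<noteq> y" "x \<notin> cball 0 r \<or> y \<notin> cball 0 r" for x y r
  proof -
    have "(lip0_apply f x - lip0_apply f y) / dist x y \<le> sup0 (A r)"
      using that by (intro sup0_upper bdd A_I)
    moreover have "(lip0_apply f y - lip0_apply f x) / dist y x \<le> sup0 (A r)"
      using that by (intro sup0_upper bdd A_I) auto
    ultimately show ?thesis
      using that(1) by (simp add: divide_le_eq dist_commute abs_le_iff)
  qed
  have nonneg: "0 \<le> sup0 (A r)" for r
  proof (cases "A r = {}")
    case False
    then obtain a where "a \<in> A r" by blast
    from A_E[OF this] obtain x y :: 'a
      where xy: "x \<noteq> y" "x \<notin> cball 0 r \<or> y \<notin> cball 0 r"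
      by (elim exE conjE) (rule that; assumption)
    have "0 \<le> sup0 (A r) * dist x y"
      using up[OF xy] abs_ge_zero order_trans by blast
    then show ?thesis using xy(1) by (simp add: zero_le_mult_iff)
  qed (simp add: sup0_def)
  have "((\<lambda>r. sup0 (A r)) \<longlongrightarrow> 0) at_top \<longleftrightarrow> ?R"
  proof
    assume L: "((\<lambda>r. sup0 (A r)) \<longlongrightarrow> 0) at_top"
    show ?R
    proof (intro allI impI)
      fix e :: real assume "0 < e"
      then have "\<forall>\<^sub>F r in at_top. sup0 (A r) < e"
        by (rule order_tendstoD(2)[OF L])
      then obtain R where R: "sup0 (A R) < e"
        by (auto simp: eventually_at_top_linorder)
      show "\<exists>R. \<forall>x y. x \<noteq> y \<and> (x \<notin> cball 0 R \<or> y \<notin> cball 0 R) \<longrightarrow>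
          \<bar>lip0_apply f x - lip0_apply f y\<bar> \<le> e * dist x y"
      proof (intro exI[of _ R] allI impI)
        fix x y :: 'a assume "x \<noteq> y \<and> (x \<notin> cball 0 R \<or> y \<notin> cball 0 R)"
        then have "\<bar>lip0_apply f x - lip0_apply f y\<bar> \<le> sup0 (A R) * dist x y"
          using up[of x y R] by blast
        also have "\<dots> \<le> e * dist x y"
          using R by (intro mult_right_mono) auto
        finally show "\<bar>lip0_apply f x - lip0_apply f y\<bar> \<le> e * dist x y" .
      qed
    qed
  next
    assume R: ?R
    show "((\<lambda>r. sup0 (A r)) \<longlongrightarrow> 0) at_top"
    proof (rule tendstoI)
      fix e :: real assume "0 < e"
      then have "0 < e / 2" by simp
      from R[THEN spec[of _ "e / 2"], THEN mp, OF this]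
      obtain S where S: "\<forall>x y. x \<noteq> y \<and> (x \<notin> cball 0 S \<or> y \<notin> cball 0 S) \<longrightarrow>
          \<bar>lip0_apply f x - lip0_apply f y\<bar> \<le> e / 2 * dist x y"
        by (elim exE) (rule that)
      show "\<forall>\<^sub>F r in at_top. dist (sup0 (A r)) 0 < e"
      proof (rule eventually_at_top_linorderI[of S])
        fix r assume "S \<le> r"
        have "sup0 (A r) \<le> e / 2"
        proof (rule sup0_least)
          fix a assume "a \<in> A r"
          from A_E[OF this] obtain x y where xy: "x \<noteq> y" "x \<notin> cball 0 r \<or> y \<notin> cball 0 r"
            and a: "a = (lip0_apply f x - lip0_apply f y) / dist x y"
            by (elim exE conjE) (rule that; assumption)
          have "x \<notin> cball 0 S \<or> y \<notin> cball 0 S"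
            using xy(2) \<open>S \<le> r\<close> by auto
          from S[THEN spec[of _ x], THEN spec[of _ y], THEN mp, OF conjI, OF xy(1) this]
          have "\<bar>lip0_apply f x - lip0_apply f y\<bar> \<le> e / 2 * dist x y" .
          then have "lip0_apply f x - lip0_apply f y \<le> e / 2 * dist x y"
            by linarith
          then show "a \<le> e / 2"
            using xy(1) by (simp add: a divide_le_eq)
        qed (use \<open>0 < e\<close> in simp)
        then show "dist (sup0 (A r)) 0 < e"
          using nonneg[of r] \<open>0 < e\<close> by (simp add: dist_real_def)
      qed
    qed
  qed
  then show ?thesis by (simp add: flat_at_infinity_def A_def)
qed

lemma lip0_u_locally_flatD:
  assumes "f \<in> lip0_u" "0 < \<epsilon>"
  shows "\<exists>\<delta>>0. \<forall>x y. x \<noteq> y \<and> dist x y < \<delta> \<longrightarrow>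
    \<bar>lip0_apply f x - lip0_apply f y\<bar> < \<epsilon> * dist x y"
  using assms by (simp add: lip0_u_def uniformly_locally_flat_def)

lemma lip0_u_flat_at_infinityD:
  assumes "f \<in> lip0_u" "0 < \<epsilon>"
  shows "\<exists>R. \<forall>x y. x \<noteq> y \<and> (x \<notin> cball 0 R \<or> y \<notin> cball 0 R) \<longrightarrow>
    \<bar>lip0_apply f x - lip0_apply f y\<bar> \<le> \<epsilon> * dist x y"
proof -
  have "flat_at_infinity (lip0_apply f)" using assms(1) by (simp add: lip0_u_def)
  from this[unfolded flat_at_infinity_iff, THEN spec, THEN mp, OF assms(2)] show ?thesis .
qed

lemma subspace_lip0_u: "subspace (lip0_u :: 'a::{metric_space, zero} lip0 set)"
proof (rule subspaceI)
  show "0 \<in> (lip0_u :: 'a lip0 set)"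
    by (auto simp: lip0_u_def flat_at_infinity_iff uniformly_locally_flat_def lip0_apply_simps
        intro: exI[of _ 1])
next
  fix f g :: "'a lip0"
  assume f: "f \<in> lip0_u" and g: "g \<in> lip0_u"
  have "uniformly_locally_flat (lip0_apply (f + g))"
    unfolding uniformly_locally_flat_def
  proof (intro allI impI)
    fix e :: real assume "0 < e"
    then have e: "0 < e / 2" by simp
    obtain d1 where d1: "0 < d1" "\<And>x y. x \<noteq> y \<Longrightarrow> dist x y < d1 \<Longrightarrow>
        \<bar>lip0_apply f x - lip0_apply f y\<bar> < e / 2 * dist x y"
      using lip0_u_locally_flatD[OF f e] by metis
    obtain d2 where d2: "0 < d2" "\<And>x y. x \<noteq> y \<Longrightarrow> dist x y < d2 \<Longrightarrow>
        \<bar>lip0_apply g x - lip0_apply g y\<bar> < e / 2 * dist x y"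
      using lip0_u_locally_flatD[OF g e] by metis
    have "\<bar>lip0_apply (f + g) x - lip0_apply (f + g) y\<bar> < e * dist x y"
      if "x \<noteq> y" "dist x y < min d1 d2" for x y
      proof -
      have "dist x y < d1" "dist x y < d2"
        using that(2) by auto
      from d1(2)[OF that(1) this(1)] d2(2)[OF that(1) this(2)] show ?thesis
        unfolding lip0_apply_simps by linarith
    qed
    then show "\<exists>\<delta>>0. \<forall>x y. x \<noteq> y \<and> dist x y < \<delta> \<longrightarrow>
        \<bar>lip0_apply (f + g) x - lip0_apply (f + g) y\<bar> < e * dist x y"
      using d1(1) d2(1) by (intro exI[of _ "min d1 d2"]) auto
  qed
  moreover have "flat_at_infinity (lip0_apply (f + g))"
    unfolding flat_at_infinity_iff
  proof (intro allI impI)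
    fix e :: real assume "0 < e"
    then have e: "0 < e / 2" by simp
    obtain R1 where R1: "\<forall>x y. x \<noteq> y \<and> (x \<notin> cball 0 R1 \<or> y \<notin> cball 0 R1) \<longrightarrow>
        \<bar>lip0_apply f x - lip0_apply f y\<bar> \<le> e / 2 * dist x y"
      using lip0_u_flat_at_infinityD[OF f e] by (elim exE) (rule that)
    obtain R2 where R2: "\<forall>x y. x \<noteq> y \<and> (x \<notin> cball 0 R2 \<or> y \<notin> cball 0 R2) \<longrightarrow>
        \<bar>lip0_apply g x - lip0_apply g y\<bar> \<le> e / 2 * dist x y"
      using lip0_u_flat_at_infinityD[OF g e] by (elim exE) (rule that)
    have *: "\<bar>lip0_apply (f + g) x - lip0_apply (f + g) y\<bar> \<le> e * dist x y"
      if xy: "x \<noteq> y \<and> (x \<notin> cball 0 (max R1 R2) \<or> y \<notin> cball 0 (max R1 R2))" for x y :: 'a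
    proof -
      have "x \<notin> cball 0 R1 \<or> y \<notin> cball 0 R1" "x \<notin> cball 0 R2 \<or> y \<notin> cball 0 R2"
        using xy by auto
      then have "\<bar>lip0_apply f x - lip0_apply f y\<bar> \<le> e / 2 * dist x y"
        "\<bar>lip0_apply g x - lip0_apply g y\<bar> \<le> e / 2 * dist x y"
        using xy R1[rule_format, of x y] R2[rule_format, of x y] by blast+
      then show ?thesis
        unfolding lip0_apply_simps by linarith
    qed
    show "\<exists>R. \<forall>x y. x \<noteq> y \<and> (x \<notin> cball 0 R \<or> y \<notin> cball 0 R) \<longrightarrow>
        \<bar>lip0_apply (f + g) x - lip0_apply (f + g) y\<bar> \<le> e * dist x y"
      by (intro exI[of _ "max R1 R2"] allI impI) (rule *)
  qed
  ultimately show "f + g \<in> lip0_u" by (simp add: lip0_u_def)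
next
  fix c :: real and f :: "'a lip0"
  assume f: "f \<in> lip0_u"
  show "c *\<^sub>R f \<in> lip0_u"
  proof (cases "c = 0")
    case True
    then have "lip0_apply (c *\<^sub>R f) = (\<lambda>_. 0)" by (simp add: lip0_apply_simps fun_eq_iff)
    then show ?thesis
      by (auto simp: lip0_u_def flat_at_infinity_iff uniformly_locally_flat_def
          intro: exI[of _ 1])
  next
    case False
    have eq: "\<bar>lip0_apply (c *\<^sub>R f) x - lip0_apply (c *\<^sub>R f) y\<bar> =
        \<bar>c\<bar> * \<bar>lip0_apply f x - lip0_apply f y\<bar>" for x y
      by (simp add: lip0_apply_simps abs_mult[symmetric] right_diff_distrib)
    have "uniformly_locally_flat (lip0_apply (c *\<^sub>R f))"
      unfolding uniformly_locally_flat_def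
    proof (intro allI impI)
      fix e :: real assume "0 < e"
      then have e: "0 < e / \<bar>c\<bar>" using False by simp
      obtain d where "0 < d" "\<And>x y. x \<noteq> y \<Longrightarrow> dist x y < d \<Longrightarrow>
          \<bar>lip0_apply f x - lip0_apply f y\<bar> < e / \<bar>c\<bar> * dist x y"
        using lip0_u_locally_flatD[OF f e] by metis
      then show "\<exists>\<delta>>0. \<forall>x y. x \<noteq> y \<and> dist x y < \<delta> \<longrightarrow>
          \<bar>lip0_apply (c *\<^sub>R f) x - lip0_apply (c *\<^sub>R f) y\<bar> < e * dist x y"
        using False by (intro exI[of _ d]) (auto simp: eq field_simps)
    qed
    moreover have "flat_at_infinity (lip0_apply (c *\<^sub>R f))"
      unfolding flat_at_infinity_iff
    proof (intro allI impI)
      fix e :: real assume "0 < e"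
      then have e: "0 < e / \<bar>c\<bar>" using False by simp
      obtain R where R: "\<forall>x y. x \<noteq> y \<and> (x \<notin> cball 0 R \<or> y \<notin> cball 0 R) \<longrightarrow>
          \<bar>lip0_apply f x - lip0_apply f y\<bar> \<le> e / \<bar>c\<bar> * dist x y"
        using lip0_u_flat_at_infinityD[OF f e] by (elim exE) (rule that)
      have *: "\<bar>lip0_apply (c *\<^sub>R f) x - lip0_apply (c *\<^sub>R f) y\<bar> \<le> e * dist x y"
        if "x \<noteq> y \<and> (x \<notin> cball 0 R \<or> y \<notin> cball 0 R)" for x y
        using R[THEN spec, THEN spec, THEN mp, OF that] False by (simp add: eq field_simps)
      show "\<exists>R. \<forall>x y. x \<noteq> y \<and> (x \<notin> cball 0 R \<or> y \<notin> cball 0 R) \<longrightarrow>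
          \<bar>lip0_apply (c *\<^sub>R f) x - lip0_apply (c *\<^sub>R f) y\<bar> \<le> e * dist x y"
        by (intro exI[of _ R] allI impI) (rule *)
    qed
    ultimately show ?thesis by (simp add: lip0_u_def)
  qed
qed

section \<open>M-ideals\<close>

definition annihilator :: "'a::real_normed_vector set \<Rightarrow> ('a \<Rightarrow>\<^sub>L real) set" where
  "annihilator Y = {\<phi>. \<forall>y\<in>Y. blinfun_apply \<phi> y = 0}"

definition is_M_ideal :: "'a::banach set \<Rightarrow> bool" where
  "is_M_ideal Y \<longleftrightarrow> subspace Y \<and>
    (\<exists>P :: ('a \<Rightarrow>\<^sub>L real) \<Rightarrow> ('a \<Rightarrow>\<^sub>L real).
      linear P \<and> (\<forall>\<phi>. P (P \<phi>) = P \<phi>) \<and> {\<phi>. P \<phi> = 0} = annihilator Y \<and>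
      (\<forall>\<phi>. norm \<phi> = norm (P \<phi>) + norm (\<phi> - P \<phi>)))"

section \<open>The unit interval with an additional point at distance one half\<close>

text \<open>\<^term>\<open>Some t\<close> encodes the point \<open>t\<close> of the unit interval, and \<^term>\<open>None\<close> the additional
  point \<open>p\<close>.\<close>

typedef interval_p = "insert None (Some ` {0..1}) :: real option set"
  by blast

definition pt_p :: interval_p where
  "pt_p = Abs_interval_p None"

definition pt :: "real \<Rightarrow> interval_p" where
  "pt t = Abs_interval_p (Some t)"

instantiation interval_p :: "{metric_space, zero}"
begin

definition zero_interval_p :: interval_p where
  "0 = pt 0"

definition dist_interval_p :: "interval_p \<Rightarrow> interval_p \<Rightarrow> real" where
  "dist x y =
    (case (Rep_interval_p x, Rep_interval_p y) of
      (Some s, Some t) \<Rightarrow> \<bar>s - t\<bar>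
    | (None, None) \<Rightarrow> 0
    | _ \<Rightarrow> 1 / 2)"

definition uniformity_interval_p :: "(interval_p \<times> interval_p) filter" where
  "uniformity = (INF e\<in>{0<..}. principal {(x, y :: interval_p). dist x y < e})"

definition open_interval_p :: "interval_p set \<Rightarrow> bool" where
  "open (U :: interval_p set) \<longleftrightarrow> (\<forall>x\<in>U. \<forall>\<^sub>F (x', y) in uniformity. x' = x \<longrightarrow> y \<in> U)"

instance
proof
  fix x y z :: interval_p
  show "dist x y = 0 \<longleftrightarrow> x = y"
    by (auto simp: dist_interval_p_def Rep_interval_p_inject[symmetric] split: option.splits)
  show "dist x y \<le> dist x z + dist y z"
    using Rep_interval_p[of x] Rep_interval_p[of y] Rep_interval_p[of z]
    by (auto simp: dist_interval_p_def split: option.splits)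
  show "uniformity = (INF e\<in>{0<..}. principal {(x, y :: interval_p). dist x y < e})"
    by (rule uniformity_interval_p_def)
  show "open U \<longleftrightarrow> (\<forall>x\<in>U. \<forall>\<^sub>F (x', y) in uniformity. x' = x \<longrightarrow> y \<in> U)" for U :: "interval_p set"
    by (rule open_interval_p_def)
qed

end

lemma interval_p_cases: "x = pt_p \<or> (\<exists>t\<in>{0..1}. x = pt t)"
  by (cases x) (auto simp: pt_p_def pt_def)

lemma pt_neq: "t \<in> {0..1} \<Longrightarrow> pt t \<noteq> pt_p"
  by (simp add: pt_p_def pt_def Abs_interval_p_inject)

lemma dist_pt_pt: "s \<in> {0..1} \<Longrightarrow> t \<in> {0..1} \<Longrightarrow> dist (pt s) (pt t) = \<bar>s - t\<bar>"
  by (simp add: dist_interval_p_def pt_def Abs_interval_p_inverse)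

lemma dist_pt_p: "x \<noteq> y \<Longrightarrow> x = pt_p \<or> y = pt_p \<Longrightarrow> dist x y = 1 / 2"
  by (auto simp: dist_interval_p_def pt_p_def Abs_interval_p_inverse
      Rep_interval_p_inject[symmetric] split: option.splits)

end

theory Submission
  imports Defs
begin

text \<open>
  A uniformly locally flat function on the interval has derivative zero, hence is constant there;
  so the subspace consists of the multiples of the indicator \<open>e\<close> of the isolated point \<open>p\<close>.
  Functionals that agree on an \<open>M\<close>-ideal coincide as soon as they attain their norms at one
  of its nonzero elements (\<open>M_ideal_norm_attaining_unique\<close>). Here this uniqueness fails: all points
  of the interval are equally far from \<open>p\<close>, so for each \<open>t\<close> the difference quotient
  \<open>f \<mapsto> (f(p) - f(t)) / (1/2)\<close> has norm one and attains it at \<open>e\<close>, and all these quotients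
  agree on the subspace; but as functionals on \<open>Lip\<^sub>0\<close> they differ.
\<close>

text \<open>For \<open>\<phi>\<close> attaining its norm at \<open>y \<in> Y\<close>, the projection \<open>P \<phi>\<close> takes the same value at \<open>y\<close>,
  so it is at least as large in norm as \<open>\<phi>\<close>; the norm equation then leaves no room for
  \<open>\<phi> - P \<phi>\<close>. Finally \<open>P \<phi>\<close> depends only on the restriction of \<open>\<phi>\<close> to \<open>Y\<close>.\<close>

lemma M_ideal_norm_attaining_unique:
  fixes \<phi> \<psi> :: "'a::banach \<Rightarrow>\<^sub>L real"
  assumes M: "is_M_ideal Y"
    and y: "y \<in> Y" "y \<noteq> 0"
    and \<phi>: "norm \<phi> * norm y \<le> blinfun_apply \<phi> y"
    and \<psi>: "norm \<psi> * norm y \<le> blinfun_apply \<psi> y"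
    and agree: "\<And>z. z \<in> Y \<Longrightarrow> blinfun_apply \<phi> z = blinfun_apply \<psi> z"
  shows "\<phi> = \<psi>"
proof -
  obtain P :: "('a \<Rightarrow>\<^sub>L real) \<Rightarrow> ('a \<Rightarrow>\<^sub>L real)" where
    lin: "linear P" and idem: "\<And>\<theta>. P (P \<theta>) = P \<theta>" and ker: "{\<theta>. P \<theta> = 0} = annihilator Y"
    and norm_split: "\<And>\<theta>. norm \<theta> = norm (P \<theta>) + norm (\<theta> - P \<theta>)"
    using M unfolding is_M_ideal_def by blast
  have fixed: "P \<theta> = \<theta>" if attains: "norm \<theta> * norm y \<le> blinfun_apply \<theta> y" for \<theta>
  proof -
    have "P (\<theta> - P \<theta>) = 0"
      by (simp add: linear_diff[OF lin] idem)
    then have "\<theta> - P \<theta> \<in> annihilator Y"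
      using ker by blast
    then have "blinfun_apply \<theta> y = blinfun_apply (P \<theta>) y"
      using y(1) by (simp add: annihilator_def blinfun.diff_left)
    then have "norm \<theta> * norm y \<le> norm (P \<theta>) * norm y"
      using attains norm_blinfun[of "P \<theta>" y] by simp
    then have "norm \<theta> \<le> norm (P \<theta>)"
      using y(2) by simp
    then show ?thesis
      using norm_split[of \<theta>] norm_ge_zero[of "\<theta> - P \<theta>"] by simp
  qed
  have "\<phi> - \<psi> \<in> annihilator Y"
    using agree by (simp add: annihilator_def blinfun.diff_left)
  then have "P (\<phi> - \<psi>) = 0"
    using ker by blast
  then have "P \<phi> = P \<psi>"
    by (simp add: linear_diff[OF lin])
  then show ?thesis
    using fixed[OF \<phi>] fixed[OF \<psi>] by simp
qed

lemma uniformly_locally_flat_constant_on_interval: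
  assumes flat: "uniformly_locally_flat f" and s: "s \<in> {0..1}" and t: "t \<in> {0..1}"
  shows "f (pt s) = f (pt t)"
proof -
  have "((f \<circ> pt) has_derivative (\<lambda>h. 0)) (at x within {0..1})" if x: "x \<in> {0..1}" for x
    unfolding has_derivative_within_alt
  proof (intro conjI allI impI)
    fix \<epsilon> :: real assume "0 < \<epsilon>"
    then obtain \<delta> where "0 < \<delta>"
      and \<delta>: "\<And>u v. u \<noteq> v \<Longrightarrow> dist u v < \<delta> \<Longrightarrow> \<bar>f u - f v\<bar> < \<epsilon> * dist u v"
      using flat unfolding uniformly_locally_flat_def by meson
    have "norm ((f \<circ> pt) y - (f \<circ> pt) x - 0) \<le> \<epsilon> * norm (y - x)"
      if "y \<in> {0..1}" "norm (y - x) < \<delta>" for y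
      using \<delta>[of "pt y" "pt x"] that \<open>0 < \<epsilon>\<close> dist_pt_pt[OF that(1) x]
      by (cases "pt y = pt x") auto
    then show "\<exists>\<delta>>0. \<forall>y\<in>{0..1}. norm (y - x) < \<delta> \<longrightarrow>
        norm ((f \<circ> pt) y - (f \<circ> pt) x - 0) \<le> \<epsilon> * norm (y - x)"
      using \<open>0 < \<delta>\<close> by blast
  qed simp
  then obtain c where "\<And>x. x \<in> {0..1} \<Longrightarrow> (f \<circ> pt) x = c"
    using has_derivative_zero_constant[of "{0..1::real}" "f \<circ> pt"] by auto
  then show ?thesis
    using s t by simp
qed

lemma zero_neq_pt_p: "(0::interval_p) \<noteq> pt_p"
  by (simp add: zero_interval_p_def pt_neq)

lemma dist_0_interval_p_le: "dist (0::interval_p) x \<le> 1"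
  using interval_p_cases[of x] dist_pt_p[OF zero_neq_pt_p]
  by (auto simp: zero_interval_p_def dist_pt_pt)

definition bump_p :: "interval_p lip0" where
  "bump_p = Lip0 (\<lambda>x. if x = pt_p then 1 else 0)"

lemma bump_p_apply: "lip0_apply bump_p x = (if x = pt_p then 1 else 0)"
proof -
  have "\<bar>(if u = pt_p then 1 else 0) - (if v = pt_p then 1 else (0::real))\<bar> \<le> 2 * dist u v" for u v
    using dist_pt_p[of u v] by (cases "u = v") auto
  from lip0_memI[OF this] show ?thesis
    unfolding bump_p_def by (subst Lip0_inverse) (auto simp: zero_neq_pt_p)
qed

lemma norm_bump_p_le: "norm bump_p \<le> 2"
proof (rule lip0_norm_le)
  fix u v
  show "\<bar>lip0_apply bump_p u - lip0_apply bump_p v\<bar> \<le> 2 * dist u v"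
    using dist_pt_p[of u v] by (cases "u = v") (auto simp: bump_p_apply)
qed simp

lemma bump_p_in_lip0_u: "bump_p \<in> lip0_u"
proof -
  have "uniformly_locally_flat (lip0_apply bump_p)"
    unfolding uniformly_locally_flat_def
  proof (intro allI impI)
    fix \<epsilon> :: real assume "0 < \<epsilon>"
    have "\<bar>lip0_apply bump_p x - lip0_apply bump_p y\<bar> < \<epsilon> * dist x y"
      if "x \<noteq> y" "dist x y < 1 / 2" for x y
      using that dist_pt_p[of x y] \<open>0 < \<epsilon>\<close> by (auto simp: bump_p_apply)
    then show "\<exists>\<delta>>0. \<forall>x y. x \<noteq> y \<and> dist x y < \<delta> \<longrightarrow>
        \<bar>lip0_apply bump_p x - lip0_apply bump_p y\<bar> < \<epsilon> * dist x y"
      by (intro exI[of _ "1 / 2"]) auto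
  qed
  moreover have "flat_at_infinity (lip0_apply bump_p)"
    unfolding flat_at_infinity_iff
    by (intro allI impI exI[of _ 1]) (simp add: dist_0_interval_p_le)
  ultimately show ?thesis
    by (simp add: lip0_u_def)
qed

text \<open>The witness is the coordinate on the interval, with the value \<open>1/2\<close> at \<open>p\<close>: for Lipschitz
  constant one, the only value within distance \<open>1/2\<close> of all coordinates.\<close>

lemma lip0_separates_ends: "\<exists>f :: interval_p lip0. lip0_apply f (pt 1) \<noteq> lip0_apply f (pt 0)"
proof -
  define g where "g x = (case Rep_interval_p x of Some t \<Rightarrow> t | None \<Rightarrow> 1 / 2)" for x
  have g_lip: "\<bar>g u - g v\<bar> \<le> 1 * dist u v" for u v
    using Rep_interval_p[of u] Rep_interval_p[of v]
    by (auto simp: g_def dist_interval_p_def abs_le_iff split: option.splits)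
  have g_pt: "g (pt t) = t" if "t \<in> {0..1}" for t
    using that by (simp add: g_def pt_def Abs_interval_p_inverse)
  have "lip0_apply (Lip0 g) = g"
    by (intro Lip0_inverse lip0_memI[OF g_lip]) (simp add: zero_interval_p_def g_pt)
  then show ?thesis
    by (intro exI[of _ "Lip0 g"]) (simp add: g_pt)
qed

definition quot_p :: "real \<Rightarrow> interval_p lip0 \<Rightarrow>\<^sub>L real" where
  "quot_p t = Blinfun (\<lambda>f. (lip0_apply f pt_p - lip0_apply f (pt t)) / (1 / 2))"

context
  fixes t :: real
  assumes t: "t \<in> {0..1}"
begin

lemma quotient_p_le_norm:
  "norm ((lip0_apply f pt_p - lip0_apply f (pt t)) / (1 / 2)) \<le> norm f"
  using lip0_norm_bound[of f pt_p "pt t"] dist_pt_p[of pt_p "pt t"] pt_neq[OF t]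
  by (auto simp: abs_if algebra_simps split: if_splits)

lemma quot_p_apply:
  "blinfun_apply (quot_p t) f = (lip0_apply f pt_p - lip0_apply f (pt t)) / (1 / 2)"
proof -
  have "bounded_linear (\<lambda>f. (lip0_apply f pt_p - lip0_apply f (pt t)) / (1 / 2))"
    by (rule bounded_linear_intro[where K = 1])
      (use quotient_p_le_norm in \<open>auto simp: lip0_apply_simps algebra_simps\<close>)
  then show ?thesis
    by (simp add: quot_p_def bounded_linear_Blinfun_apply)
qed

lemma norm_quot_p_le: "norm (quot_p t) \<le> 1"
  by (rule norm_blinfun_bound) (use quotient_p_le_norm in \<open>simp_all add: quot_p_apply\<close>)

lemma quot_p_attains_norm:
  "norm (quot_p t) * norm bump_p \<le> blinfun_apply (quot_p t) bump_p"
proof -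
  have "norm (quot_p t) * norm bump_p \<le> 1 * 2"
    by (intro mult_mono norm_quot_p_le norm_bump_p_le) simp_all
  also have "\<dots> = blinfun_apply (quot_p t) bump_p"
    by (simp add: quot_p_apply bump_p_apply pt_neq[OF t])
  finally show ?thesis .
qed

end

theorem mainTheorem6:
  shows "\<not> is_M_ideal (lip0_u :: interval_p lip0 set)"
proof
  assume M: "is_M_ideal (lip0_u :: interval_p lip0 set)"
  have "bump_p \<noteq> 0"
    by (metis bump_p_apply lip0_apply_0 zero_neq_one)
  moreover have "blinfun_apply (quot_p 1) f = blinfun_apply (quot_p 0) f" if "f \<in> lip0_u" for f
    using that uniformly_locally_flat_constant_on_interval[of "lip0_apply f" 1 0]
    by (simp add: lip0_u_def quot_p_apply)
  ultimately have "quot_p 1 = quot_p 0"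
    by (intro M_ideal_norm_attaining_unique[OF M bump_p_in_lip0_u] quot_p_attains_norm) simp_all
  then have "lip0_apply f (pt 1) = lip0_apply f (pt 0)" for f
    using quot_p_apply[of 1 f] quot_p_apply[of 0 f] by simp
  then show False
    using lip0_separates_ends by blast
qed

end
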